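(* Let $D\ge 1$ and $d\ge 2$ be fixed integers. Let $\mathbf{s}\in\{0,\ldots,D-1\}^\infty$ be a full template and let $\{\mathbf{s}^N\}_{N=1}^\infty$ be a sequence of templates in $\{0,\ldots,D-1\}^\infty$ that converges to $\mathbf{s}$ as $N\to\infty$. Then $$\lim_{N\to\infty}\mathrm{dist}\left(\mathcal{M}^{\mathbf{s}^N},\mathcal{M}^{\mathbf{s}}\right)=0,$$ where $\mathrm{dist}(A,B)=\sup_{a\in A}\inf_{b\in B}\mathrm{dist}(a,b)$ is the one-sided distance from $A$ to $B$.
   Context: Templates: a template is a sequence $\mathbf{s}=\{s_m\}_{m=1}^\infty\in\{0,\ldots,D-1\}^\infty$. It is called full if for each $0\le i\le D-1$ there is at least one $m\ge 1$ with $s_m=i$. The space of templates carries the metric $\|\mathbf{s}-\tilde{\mathbf{s}}\|=\sum_{k=1}^\infty |s_k-\tilde s_k|/D^k$, and convergence of templates is with respect to this metric. Template iteration: for $\mathbf{c}=(c_0,\ldots,c_{D-1})\in\mathbb{C}^D$ and $\mathbf{d}=(d_0,\ldots,d_{D-1})\in\{2,\ldots,d\}^D$, put $f_{(c_i,d_i)}(z)=z^{d_i}+c_i$. For a template $\mathbf{s}$ let $P_m^{\mathbf{s},\mathbf{c},\mathbf{d}}=f_{(c_{s_m},d_{s_m})}$ for $m\ge 1$, and for $0\le m<n$ let $Q_{m,n}^{\mathbf{s},\mathbf{c},\mathbf{d}}=P_n^{\mathbf{s},\mathbf{c},\mathbf{d}}\circ\cdots\circ P_{m+1}^{\mathbf{s},\mathbf{c},\mathbf{d}}$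 (with $Q_{m,m}$ the identity). Fixed-template Mandelbrot set (with degree bound $d$): $\mathcal{M}^{\mathbf{s}}$ is the set of all $(\mathbf{c},\mathbf{d})\in\mathbb{C}^D\times\{2,\ldots,d\}^D$ such that for every $m\ge 0$ the sequence $\{Q_{m,n}^{\mathbf{s},\mathbf{c},\mathbf{d}}(0)\}_{n\ge m}$ is bounded. Metric on parameter space: on $\mathbb{C}^D\times\{2,\ldots,d\}^D$, $\mathrm{dist}((\mathbf{c},\mathbf{d}),(\tilde{\mathbf{c}},\tilde{\mathbf{d}}))=\max_{0\le i\le D-1}\max\{|\tilde c_i-c_i|,|\tilde d_i-d_i|\}$. *)

theory Defs
  imports "HOL-Analysis.Analysis"
begin

(* Templates are indexed from m = 1; the value s 0 is never used. *)
definition is_template :: "nat \<Rightarrow> (nat \<Rightarrow> nat) \<Rightarrow> bool" where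
  "is_template D s \<longleftrightarrow> (\<forall>m\<ge>1. s m < D)"

definition full_template :: "nat \<Rightarrow> (nat \<Rightarrow> nat) \<Rightarrow> bool" where
  "full_template D s \<longleftrightarrow> is_template D s \<and> (\<forall>i<D. \<exists>m\<ge>1. s m = i)"

(* The sum over k >= 1 is shifted to start at 0.  On templates it always converges
   (for D = 1 all terms vanish). *)
definition template_dist :: "nat \<Rightarrow> (nat \<Rightarrow> nat) \<Rightarrow> (nat \<Rightarrow> nat) \<Rightarrow> real" where
  "template_dist D s t = (\<Sum>k. \<bar>real (s (Suc k)) - real (t (Suc k))\<bar> / real D ^ Suc k)"

(* A pair (c, ds) of vectors with entries c i, ds i for i < D; the vectors are extensional
   functions, so that each point of the product has exactly one representative. *)
type_synonym param = "(nat \<Rightarrow> complex) \<times> (nat \<Rightarrow> nat)"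

definition param_space :: "nat \<Rightarrow> nat \<Rightarrow> param set" where
  "param_space D d = ({..<D} \<rightarrow>\<^sub>E UNIV) \<times> ({..<D} \<rightarrow>\<^sub>E {2..d})"

definition param_dist :: "nat \<Rightarrow> param \<Rightarrow> param \<Rightarrow> real" where
  "param_dist D p q =
     Max ((\<lambda>i. max (cmod (fst q i - fst p i)) \<bar>real (snd q i) - real (snd p i)\<bar>) ` {..<D})"

definition template_P :: "(nat \<Rightarrow> nat) \<Rightarrow> param \<Rightarrow> nat \<Rightarrow> complex \<Rightarrow> complex" where
  "template_P s p m z = z ^ snd p (s m) + fst p (s m)"

(* Q m n = P n o ... o P (m+1) for m < n, and the identity for n = m;
   the value for n < m is a dummy. *)
primrec template_Q :: "(nat \<Rightarrow> nat) \<Rightarrow> param \<Rightarrow> nat \<Rightarrow> nat \<Rightarrow> complex \<Rightarrow> complex" where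
  "template_Q s p m 0 = id"
| "template_Q s p m (Suc n) =
     (if m \<le> n then template_P s p (Suc n) \<circ> template_Q s p m n else id)"

definition mandelbrot :: "nat \<Rightarrow> nat \<Rightarrow> (nat \<Rightarrow> nat) \<Rightarrow> param set" where
  "mandelbrot D d s =
     {p \<in> param_space D d. \<forall>m. bounded ((\<lambda>n. template_Q s p m n 0) ` {m..})}"

(* Extended-valued: the set of a template that is not full is unbounded, and its
   one-sided distance to a bounded set is infinite. *)
definition one_sided_dist :: "nat \<Rightarrow> param set \<Rightarrow> param set \<Rightarrow> ennreal" where
  "one_sided_dist D A B = (SUP a\<in>A. INF b\<in>B. ennreal (param_dist D a b))"

end

theory Submission imports Defs begin

text \<open>
  The argument is one of upper semicontinuity.  If all \<open>|c\<^sub>i| \<le> 2\<close>, then an orbit that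
  leaves the closed disc of radius \<open>2\<close> escapes to infinity; and for a full template every
  \<open>c\<^sub>i\<close> is itself the first iterate of the critical point \<open>0\<close> from some starting time, so
  a coefficient of maximal modulus exceeding \<open>2\<close> would produce an escaping orbit.  Hence, for a
  full template, the Mandelbrot set is the intersection of the decreasing sequence of sets
  \<open>E\<^sub>K\<close> of parameters with \<open>|c\<^sub>i| \<le> 2\<close> whose critical orbits stay in the disc of radius \<open>2\<close> up
  to time \<open>K\<close> (\<open>mandelbrot_eq_Inter\<close>).

  These sets are compact (in the product topology, with the degrees discrete), so every
  \<open>\<epsilon>\<close>-neighbourhood of the intersection contains some \<open>E\<^sub>K\<close> (\<open>bounded_upto_near_mandelbrot\<close>).
  Moreover \<open>E\<^sub>K\<close> depends only on the first \<open>K\<close> entries of the template, and a template close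
  to \<open>s\<close> agrees with \<open>s\<close> on these (\<open>eventually_agree\<close>) and is full.
  So the Mandelbrot set of such a template lies in the same \<open>E\<^sub>K\<close>, hence in the \<open>\<epsilon>\<close>-neighbourhood.
\<close>

section \<open>Basic facts on template iterates\<close>

lemma template_Q_id: "n \<le> m \<Longrightarrow> template_Q s p m n = id"
  by (cases n) auto

lemma template_Q_Suc:
  "m \<le> n \<Longrightarrow> template_Q s p m (Suc n) z
     = template_Q s p m n z ^ snd p (s (Suc n)) + fst p (s (Suc n))"
  by (simp add: template_P_def)

lemma template_Q_cong:
  assumes "\<And>k. 1 \<le> k \<Longrightarrow> k \<le> n \<Longrightarrow> s k = t k"
  shows "template_Q s p m n = template_Q t p m n"
  using assms by (induction n) (auto simp: template_P_def fun_eq_iff)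

lemma param_space_degree:
  "p \<in> param_space D d \<Longrightarrow> i < D \<Longrightarrow> snd p i \<in> {2..d}"
  unfolding param_space_def mem_Times_iff by (blast dest: PiE_mem)

lemma template_less: "is_template D s \<Longrightarrow> s (Suc n) < D"
  by (simp add: is_template_def)

section \<open>Escape radius and the description of the Mandelbrot set\<close>

text \<open>
  One radius estimate serves both the bound on the coefficients and the bound on the orbits:
  an iterate of modulus greater than \<open>2\<close> that dominates all coefficients starts an escape.
\<close>
lemma escape:
  assumes p: "p \<in> param_space D d" and s: "is_template D s" and mn: "m \<le> n"
    and w: "cmod (template_Q s p m n 0) > 2"
    and c: "\<And>i. i < D \<Longrightarrow> cmod (fst p i) \<le> cmod (template_Q s p m n 0)"
  shows "\<not> bounded ((\<lambda>n. template_Q s p m n 0) ` {m..})"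
proof
  define r where "r = cmod (template_Q s p m n 0)"
  have r: "r > 2" using w by (simp add: r_def)
  \<comment> \<open>if \<open>|z| \<ge> r\<close>, then \<open>|z\<^sup>k + c| \<ge> |z|\<^sup>2 - r \<ge> |z| (|z| - 1) \<ge> |z| (r - 1)\<close>\<close>
  have step: "cmod (z ^ k + c) \<ge> cmod z * (r - 1)"
    if z: "cmod z \<ge> r" and k: "k \<ge> 2" and c: "cmod c \<le> r" for z c k
  proof -
    have "cmod z * (r - 1) \<le> cmod z * (cmod z - 1)"
      using z r by (intro mult_left_mono) auto
    also have "\<dots> = cmod z ^ 2 - cmod z" by (simp add: power2_eq_square algebra_simps)
    also have "\<dots> \<le> cmod z ^ k - cmod c"
      using z r c power_increasing[OF k, of "cmod z"] by linarith
    also have "\<dots> \<le> cmod (z ^ k + c)"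
      using norm_diff_ineq[of "z ^ k" c] by (simp add: norm_power)
    finally show ?thesis .
  qed
  have grow: "cmod (template_Q s p m (n + k) 0) \<ge> r * (r - 1) ^ k" for k
  proof (induction k)
    case 0
    then show ?case by (simp add: r_def)
  next
    case (Suc k)
    let ?z = "template_Q s p m (n + k) 0"
    have i: "s (Suc (n + k)) < D" using s by (rule template_less)
    have "1 \<le> (r - 1) ^ k" using r by (intro one_le_power) auto
    then have "r \<le> r * (r - 1) ^ k" using r by simp
    then have z: "r \<le> cmod ?z" using Suc by linarith
    have "r * (r - 1) ^ Suc k = r * (r - 1) ^ k * (r - 1)" by simp
    also have "\<dots> \<le> cmod ?z * (r - 1)"
      using Suc r by (intro mult_right_mono) auto
    also have "\<dots> \<le> cmod (?z ^ snd p (s (Suc (n + k))) + fst p (s (Suc (n + k))))"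
      using z param_space_degree[OF p i] c[OF i] by (intro step) (auto simp: r_def)
    also have "\<dots> = cmod (template_Q s p m (n + Suc k) 0)"
      using mn template_Q_Suc[of m "n + k" s p 0] by simp
    finally show ?case .
  qed
  assume "bounded ((\<lambda>n. template_Q s p m n 0) ` {m..})"
  then obtain B where B: "\<And>j. j \<ge> m \<Longrightarrow> cmod (template_Q s p m j 0) \<le> B"
    unfolding bounded_iff by auto
  obtain k where k: "B < (r - 1) ^ k" using r real_arch_pow[of "r - 1" B] by auto
  have "(r - 1) ^ k \<le> r * (r - 1) ^ k" using r by simp
  also have "\<dots> \<le> B" using grow[of k] B[of "n + k"] mn by linarith
  finally show False using k by simp
qed

text \<open>
  The set \<open>E\<^sub>K\<close>: coefficients and critical orbits up to time \<open>K\<close> stay in the closed disc of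
  radius \<open>2\<close>.  For \<open>n < m\<close> the condition on the orbit is void, the iterate being \<open>0\<close> by convention.
\<close>
definition bounded_upto :: "nat \<Rightarrow> nat \<Rightarrow> (nat \<Rightarrow> nat) \<Rightarrow> nat \<Rightarrow> param set" where
  "bounded_upto D d s K =
     {p \<in> param_space D d. (\<forall>i<D. cmod (fst p i) \<le> 2) \<and>
        (\<forall>m. \<forall>n\<le>K. cmod (template_Q s p m n 0) \<le> 2)}"

lemma bounded_upto_cong:
  assumes "\<And>k. 1 \<le> k \<Longrightarrow> k \<le> K \<Longrightarrow> s k = t k"
  shows "bounded_upto D d s K = bounded_upto D d t K"
proof -
  have "template_Q s p m n = template_Q t p m n" if "n \<le> K" for p m n
    using that assms by (intro template_Q_cong) auto
  then show ?thesis by (simp add: bounded_upto_def)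
qed

lemma full_template_coeff_le_2:
  assumes s: "full_template D s" and p: "p \<in> mandelbrot D d s" and i: "i < D"
  shows "cmod (fst p i) \<le> 2"
proof (rule ccontr)
  assume neg: "\<not> cmod (fst p i) \<le> 2"
  let ?A = "(\<lambda>i. cmod (fst p i)) ` {..<D}"
  have "Max ?A \<in> ?A" using i by (intro Max_in) auto
  then obtain j where j: "j < D" "cmod (fst p j) = Max ?A" by auto
  have max: "cmod (fst p k) \<le> cmod (fst p j)" if "k < D" for k
    using that by (simp add: j(2))
  obtain n where n: "s (Suc n) = j"
    using s j(1) unfolding full_template_def by (metis Suc_le_D One_nat_def)
  have ps: "p \<in> param_space D d" using p by (simp add: mandelbrot_def)
  have "snd p j \<ge> 2" using param_space_degree[OF ps j(1)] by simp
  then have Q: "template_Q s p n (Suc n) 0 = fst p j"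
    using n by (simp add: template_Q_Suc template_Q_id del: template_Q.simps)
  have "\<not> bounded ((\<lambda>k. template_Q s p n k 0) ` {n..})"
    using s max[OF i] neg
    by (intro escape[OF ps, where n = "Suc n"])
      (auto simp: Q max full_template_def simp del: template_Q.simps)
  then show False using p by (simp add: mandelbrot_def)
qed

lemma mandelbrot_eq_Inter:
  assumes s: "full_template D s"
  shows "mandelbrot D d s = (\<Inter>K. bounded_upto D d s K)"
proof (intro equalityI subsetI)
  fix p assume p: "p \<in> mandelbrot D d s"
  have ps: "p \<in> param_space D d" using p by (simp add: mandelbrot_def)
  note c = full_template_coeff_le_2[OF s p]
  have "cmod (template_Q s p m n 0) \<le> 2" for m n
  proof (cases "m \<le> n")
    case True
    show ?thesis
    proof (rule ccontr)
      assume big: "\<not> cmod (template_Q s p m n 0) \<le> 2"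
      have "cmod (fst p i) \<le> cmod (template_Q s p m n 0)" if "i < D" for i
        using c[OF that] big by linarith
      then have "\<not> bounded ((\<lambda>k. template_Q s p m k 0) ` {m..})"
        using s big True by (intro escape[OF ps]) (auto simp: full_template_def)
      then show False using p by (simp add: mandelbrot_def)
    qed
  qed (simp add: template_Q_id)
  then show "p \<in> (\<Inter>K. bounded_upto D d s K)"
    using ps c by (simp add: bounded_upto_def)
next
  fix p assume "p \<in> (\<Inter>K. bounded_upto D d s K)"
  then have "p \<in> param_space D d" and "cmod (template_Q s p m n 0) \<le> 2" for m n
    by (auto simp: bounded_upto_def)
  then show "p \<in> mandelbrot D d s"
    by (auto simp: mandelbrot_def bounded_iff)
qed

section \<open>Compactness of the parameter space\<close>

lemma compact_PiE:
  fixes B :: "'i \<Rightarrow> 'a::topological_space set"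
  assumes "\<And>i. i \<in> I \<Longrightarrow> compact (B i)"
  shows "compact (PiE I B)"
proof -
  \<comment> \<open>outside \<open>I\<close> an extensional function takes a single value\<close>
  have eq: "PiE I B = PiE UNIV (\<lambda>i. if i \<in> I then B i else {undefined})"
    by (auto simp: PiE_iff extensional_def split: if_splits)
  have "compactin (product_topology (\<lambda>_. euclidean) UNIV)
          (PiE UNIV (\<lambda>i. if i \<in> I then B i else {undefined}))"
    using assms by (auto simp: compactin_PiE)
  then show ?thesis
    by (simp add: eq euclidean_product_topology)
qed

lemma tendsto_template_Q:
  fixes P :: "nat \<Rightarrow> param"
  assumes s: "is_template D s"
    and c: "\<And>i. i < D \<Longrightarrow> (\<lambda>k. fst (P k) i) \<longlonglongrightarrow> fst p i"
    and d: "\<And>i. i < D \<Longrightarrow> \<forall>\<^sub>F k in sequentially. snd (P k) i = snd p i"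
  shows "(\<lambda>k. template_Q s (P k) m n z) \<longlonglongrightarrow> template_Q s p m n z"
proof (induction n)
  case (Suc n)
  show ?case
  proof (cases "m \<le> n")
    case True
    have i: "s (Suc n) < D" using s by (rule template_less)
    have "(\<lambda>k. template_Q s (P k) m n z ^ snd p (s (Suc n)) + fst (P k) (s (Suc n)))
       \<longlonglongrightarrow> template_Q s p m (Suc n) z"
      unfolding template_Q_Suc[OF True] by (intro tendsto_intros Suc c i)
    moreover have "\<forall>\<^sub>F k in sequentially.
      template_Q s (P k) m n z ^ snd p (s (Suc n)) + fst (P k) (s (Suc n))
        = template_Q s (P k) m (Suc n) z"
      using d[OF i] by eventually_elim (simp add: template_Q_Suc[OF True] del: template_Q.simps)
    ultimately show ?thesis by (rule Lim_transform_eventually)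
  qed simp
qed simp

text \<open>
  If this failed, one could choose in each \<open>E\<^sub>K\<close> a point at distance at least \<open>e\<close> from the
  Mandelbrot set; a limit point of these lies in all \<open>E\<^sub>K\<close>, hence in the Mandelbrot set.
\<close>
lemma bounded_upto_near_mandelbrot:
  assumes D: "D \<ge> 1" and s: "full_template D s" and e: "e > 0"
  shows "\<exists>K. \<forall>p\<in>bounded_upto D d s K. \<exists>q\<in>mandelbrot D d s. param_dist D p q < e"
proof (rule ccontr)
  assume "\<not> ?thesis"
  then obtain P where P: "\<And>K. P K \<in> bounded_upto D d s K"
    and far: "\<And>K q. q \<in> mandelbrot D d s \<Longrightarrow> \<not> param_dist D (P K) q < e"
    by metis
  let ?S = "({..<D} \<rightarrow>\<^sub>E cball (0::complex) 2) \<times> ({..<D} \<rightarrow>\<^sub>E {2..d})"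
  have "compact ?S"
    by (intro compact_Times compact_PiE) (auto intro: finite_imp_compact)
  then have "seq_compact ?S" by (rule compact_imp_seq_compact)
  moreover have "P K \<in> ?S" for K
    using P[of K] by (auto simp: bounded_upto_def param_space_def PiE_iff mem_Times_iff)
  ultimately obtain p r where p: "p \<in> ?S" and r: "strict_mono r" and lim: "(P \<circ> r) \<longlonglongrightarrow> p"
    unfolding seq_compact_def by metis
  have c: "(\<lambda>k. fst (P (r k)) i) \<longlonglongrightarrow> fst p i" for i
  proof -
    have "continuous_on UNIV (\<lambda>p::param. fst p i)"
      by (rule continuous_on_product_then_coordinatewise) (intro continuous_intros)
    from continuous_on_tendsto_compose[OF this lim] show ?thesis by (simp add: o_def)
  qed
  have d: "\<forall>\<^sub>F k in sequentially. snd (P (r k)) i = snd p i" for i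
  proof -
    have "continuous_on UNIV (\<lambda>p::param. snd p i)"
      by (rule continuous_on_product_then_coordinatewise) (intro continuous_intros)
    from continuous_on_tendsto_compose[OF this lim]
    have "(\<lambda>k. snd (P (r k)) i) \<longlonglongrightarrow> snd p i" by (simp add: o_def)
    then show ?thesis by (simp add: tendsto_discrete)
  qed
  have Q: "cmod (template_Q s p m n 0) \<le> 2" for m n
  proof (rule tendsto_upperbound)
    show "(\<lambda>k. cmod (template_Q s (P (r k)) m n 0)) \<longlonglongrightarrow> cmod (template_Q s p m n 0)"
      using s c d by (intro tendsto_norm tendsto_template_Q[of D]) (auto simp: full_template_def)
    have "cmod (template_Q s (P (r k)) m n 0) \<le> 2" if "k \<ge> n" for k
      using P[of "r k"] that seq_suble[OF r, of k] by (auto simp: bounded_upto_def)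
    then show "\<forall>\<^sub>F k in sequentially. cmod (template_Q s (P (r k)) m n 0) \<le> 2"
      by (auto simp: eventually_sequentially)
  qed simp
  have "p \<in> mandelbrot D d s"
    using p Q unfolding mandelbrot_eq_Inter[OF s]
    by (auto simp: bounded_upto_def param_space_def PiE_iff mem_Times_iff)
  moreover have "\<forall>\<^sub>F k in sequentially. param_dist D (P (r k)) p < e"
  proof -
    have "\<forall>\<^sub>F k in sequentially. dist (fst (P (r k)) i) (fst p i) < e \<and> snd (P (r k)) i = snd p i"
      for i using tendstoD[OF c[of i] e] d[of i] by (rule eventually_conj)
    then have "\<forall>\<^sub>F k in sequentially. \<forall>i\<in>{..<D}.
        dist (fst (P (r k)) i) (fst p i) < e \<and> snd (P (r k)) i = snd p i"
      by (intro eventually_ball_finite) auto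
    then show ?thesis
    proof eventually_elim
      case (elim k)
      have "{..<D} \<noteq> {}" using D by (auto simp: lessThan_empty_iff)
      then show ?case
        using elim e by (auto simp: param_dist_def dist_norm norm_minus_commute)
    qed
  qed
  ultimately show False
    using far by (auto simp: eventually_sequentially)
qed

section \<open>Convergence of templates\<close>

lemma template_dist_ge:
  assumes D: "D \<ge> 2" and s: "is_template D s" and t: "is_template D t"
    and ne: "s (Suc k) \<noteq> t (Suc k)"
  shows "template_dist D s t \<ge> 1 / real D ^ Suc k"
proof -
  let ?f = "\<lambda>k. \<bar>real (s (Suc k)) - real (t (Suc k))\<bar> / real D ^ Suc k"
  have "summable (\<lambda>k. (1 / real D) ^ k)" using D by (intro summable_geometric) auto
  moreover have "norm (?f k) \<le> (1 / real D) ^ k" for k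
  proof -
    have "\<bar>real (s (Suc k)) - real (t (Suc k))\<bar> \<le> real D"
      using template_less[OF s, of k] template_less[OF t, of k] by linarith
    then have "?f k \<le> real D / real D ^ Suc k" using D by (intro divide_right_mono) auto
    also have "\<dots> = (1 / real D) ^ k" using D by (simp add: power_divide)
    finally show ?thesis by simp
  qed
  ultimately have sum: "summable ?f" by (rule summable_comparison_test'[where N = 0])
  have "\<bar>real (s (Suc k)) - real (t (Suc k))\<bar> \<ge> 1" using ne by linarith
  then have "1 / real D ^ Suc k \<le> ?f k" using D by (intro divide_right_mono) auto
  also have "\<dots> \<le> suminf ?f" using sum_le_suminf[OF sum, of "{k}"] by simp
  finally show ?thesis by (simp add: template_dist_def)
qed

lemma eventually_agree:
  assumes s: "is_template D s" and t: "\<And>N. N \<ge> 1 \<Longrightarrow> is_template D (t N)"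
    and lim: "(\<lambda>N. template_dist D (t N) s) \<longlonglongrightarrow> 0"
  shows "\<forall>\<^sub>F N in sequentially. \<forall>k\<in>{1..K}. t N k = s k"
proof -
  have "\<forall>\<^sub>F N in sequentially. t N k = s k" if k: "k \<in> {1..K}" for k
  proof (cases "D \<ge> 2")
    case True
    obtain j where j: "k = Suc j" using k by (cases k) auto
    have "1 / real D ^ Suc j > 0" using True by simp
    from order_tendstoD(2)[OF lim this] eventually_ge_at_top[of 1]
    show ?thesis
    proof eventually_elim
      case (elim N)
      then show ?case
        using template_dist_ge[OF True t[of N] s, of j] by (auto simp: j)
    qed
  next
    \<comment> \<open>for \<open>D = 1\<close> there is only one template\<close>
    case False
    show ?thesis using eventually_ge_at_top[of 1]
    proof eventually_elim
      case (elim N)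
      have "t N k < D" "s k < D" using t[OF elim] s k by (auto simp: is_template_def)
      then show ?case using False by linarith
    qed
  qed
  then show ?thesis by (intro eventually_ball_finite) auto
qed

lemma one_sided_dist_le:
  assumes "\<And>a. a \<in> A \<Longrightarrow> \<exists>b\<in>B. param_dist D a b \<le> e"
  shows "one_sided_dist D A B \<le> ennreal e"
  unfolding one_sided_dist_def
proof (rule SUP_least)
  fix a assume "a \<in> A"
  then obtain b where "b \<in> B" "param_dist D a b \<le> e" using assms by blast
  then show "(INF b\<in>B. ennreal (param_dist D a b)) \<le> ennreal e"
    by (intro INF_lower2) (auto intro: ennreal_leI)
qed

section \<open>Semicontinuity of the Mandelbrot set\<close>

theorem theorem3p1:
  fixes D d :: nat and s :: "nat \<Rightarrow> nat" and sN :: "nat \<Rightarrow> nat \<Rightarrow> nat"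
  assumes "D \<ge> 1" and "d \<ge> 2"
    and "full_template D s"
    and "\<And>N. N \<ge> 1 \<Longrightarrow> is_template D (sN N)"
    and "(\<lambda>N. template_dist D (sN N) s) \<longlonglongrightarrow> 0"
  shows "(\<lambda>N. one_sided_dist D (mandelbrot D d (sN N)) (mandelbrot D d s)) \<longlonglongrightarrow> 0"
proof (rule order_tendstoI)
  fix a :: ennreal assume "0 < a"
  then obtain b where b: "0 < b" "b < a" using dense by blast
  define e where "e = enn2real b"
  have "b < top" using b(2) by (rule order.strict_trans2) simp
  then have be: "b = ennreal e" and e: "e > 0"
    using b(1) by (simp_all add: e_def enn2real_positive_iff)
  obtain K where K: "\<And>p. p \<in> bounded_upto D d s K \<Longrightarrow> \<exists>q\<in>mandelbrot D d s. param_dist D p q < e"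
    using bounded_upto_near_mandelbrot[OF assms(1,3) e] by metis
  \<comment> \<open>all symbols occur in \<open>s\<close> by some time \<open>L\<close>, so agreement up to \<open>L\<close> forces fullness\<close>
  obtain m where m: "\<And>i. i < D \<Longrightarrow> m i \<ge> 1 \<and> s (m i) = i"
    using assms(3) unfolding full_template_def by metis
  define L where "L = Max (m ` {..<D})"
  have mL: "m i \<le> L" if "i < D" for i
    using that by (simp add: L_def)
  have "is_template D s" using assms(3) by (simp add: full_template_def)
  then have "\<forall>\<^sub>F N in sequentially. \<forall>k\<in>{1..max K L}. sN N k = s k"
    using assms(4,5) by (rule eventually_agree)
  then show "\<forall>\<^sub>F N in sequentially. one_sided_dist D (mandelbrot D d (sN N)) (mandelbrot D d s) < a"
    using eventually_ge_at_top[of 1]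
  proof eventually_elim
    case (elim N)
    have "\<exists>k\<ge>1. sN N k = i" if "i < D" for i
      using m[OF that] mL[OF that] elim(1) by (intro exI[of _ "m i"]) auto
    then have "full_template D (sN N)"
      using assms(4)[OF elim(2)] by (simp add: full_template_def)
    then have "mandelbrot D d (sN N) \<subseteq> bounded_upto D d (sN N) K"
      by (auto simp: mandelbrot_eq_Inter)
    also have "\<dots> = bounded_upto D d s K"
      using elim(1) by (intro bounded_upto_cong) auto
    finally have "one_sided_dist D (mandelbrot D d (sN N)) (mandelbrot D d s) \<le> ennreal e"
      using K by (intro one_sided_dist_le) (meson less_imp_le subsetD)
    then show ?case using b(2) be by simp
  qed
qed simp

end
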